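(* Let $T=(V,E)$ be a finite tree with $|V|\ge 2$ and let $r\in V$. Let $(p_i,q_i,r_i)_{1\le i\le|V|}$ be triplets of non-negative reals with $p_i+q_i+r_i=1$ and $r_i>0$ for all $i$. Let $\mathbf t$ be distributed according to the invariant distribution of the kernel $K_r$ on $\mathrm{Subtrees}^\bullet_r(T)$ described in the context. Then $$\mathbb P(\mathbf t=t)=\nu_1(T)\prod_{i=2}^{|t|}\left(\frac{p_{i-1}}{r_i}\right)\mathbf 1_{t\in\mathrm{Subtrees}^\bullet_r(T)},$$ where $\nu_1(T)$ is the constant determined by the fact that these probabilities sum to $1$, that is, $\nu_1(T)\sum_{m=1}^{|V|}\Big(\prod_{i=2}^{m}\frac{p_{i-1}}{r_i}\Big)|\mathrm{Subtrees}^\bullet_r(T,m)|=1$.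
   Context: $\mathrm{Subtrees}^\bullet_r(T,m)$ is the set of subtrees of $T$ with $m$ vertices containing $r$ (seen as rooted at $r$), and $\mathrm{Subtrees}^\bullet_r(T)=\bigcup_m\mathrm{Subtrees}^\bullet_r(T,m)$; $|t|$ is the number of vertices of $t$. The subscripted $r_i$ are parameters, distinct from the vertex $r$. Kernel $K_r$: given $X_0=t$, pick independently an edge $\mathbf e$ uniform in $E$ and $\mathbf c\in\{+1,0,-1\}$ with probabilities $p_{|t|},q_{|t|},r_{|t|}$ respectively. - If $\mathbf c=+1$: $X_1$ is $t$ with the edge $\mathbf e$ (and its endpoints) added if $\mathbf e$ has an endpoint in $t$, and $X_1=t$ otherwise. (Since $T$ is a tree, no cycle can be created.) - If $\mathbf c=0$: $X_1=t$. - If $\mathbf c=-1$: if $\mathbf e=\{e_1,e_2\}\in E(t)$, with $e_1$ the parent of $e_2$ in $(t,r)$, and $e_2$ is a leaf of $(t,r)$ (a vertex without children; the root is never a leaf), then $X_1$ is $t$ with the vertex $e_2$ and the edge $\mathbf e$ removed; otherwise $X_1=t$. *)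

theory Defs
  imports "HOL-Probability.Probability_Mass_Function"
begin

datatype 'a graph = Graph (verts: "'a set") (edges: "'a set set")

definition finite_simple_graph :: "'a graph \<Rightarrow> bool" where
  "finite_simple_graph G \<longleftrightarrow>
     finite (verts G) \<and> (\<forall>e\<in>edges G. e \<subseteq> verts G \<and> card e = 2)"

definition path_in :: "'a graph \<Rightarrow> 'a list \<Rightarrow> bool" where
  "path_in G xs \<longleftrightarrow> xs \<noteq> [] \<and> distinct xs \<and> set xs \<subseteq> verts G \<and>
     successively (\<lambda>u v. {u, v} \<in> edges G) xs"

definition connected_graph :: "'a graph \<Rightarrow> bool" where
  "connected_graph G \<longleftrightarrow> verts G \<noteq> {} \<and>
     (\<forall>u\<in>verts G. \<forall>v\<in>verts G. \<exists>xs. path_in G xs \<and> hd xs = u \<and> last xs = v)"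

definition cycle_in :: "'a graph \<Rightarrow> 'a list \<Rightarrow> bool" where
  "cycle_in G xs \<longleftrightarrow> path_in G xs \<and> length xs \<ge> 3 \<and> {last xs, hd xs} \<in> edges G"

definition finite_tree :: "'a graph \<Rightarrow> bool" where
  "finite_tree G \<longleftrightarrow> finite_simple_graph G \<and> connected_graph G \<and> (\<nexists>xs. cycle_in G xs)"

definition subtree :: "'a graph \<Rightarrow> 'a graph \<Rightarrow> bool" where
  "subtree t T \<longleftrightarrow> finite_tree t \<and> verts t \<subseteq> verts T \<and> edges t \<subseteq> edges T"

definition rooted_subtrees_of_size :: "'a graph \<Rightarrow> 'a \<Rightarrow> nat \<Rightarrow> 'a graph set" where
  "rooted_subtrees_of_size T r m = {t. subtree t T \<and> r \<in> verts t \<and> card (verts t) = m}"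

definition rooted_subtrees :: "'a graph \<Rightarrow> 'a \<Rightarrow> 'a graph set" where
  "rooted_subtrees T r = (\<Union>m. rooted_subtrees_of_size T r m)"

text \<open>The parent of \<open>v\<close> in the tree \<open>t\<close> rooted at \<open>r\<close> is the vertex that comes just
  before \<open>v\<close> on the path from \<open>r\<close> to \<open>v\<close>; the root has no parent.\<close>

definition parent :: "'a graph \<Rightarrow> 'a \<Rightarrow> 'a \<Rightarrow> 'a \<Rightarrow> bool" where
  "parent t r u v \<longleftrightarrow> (\<exists>xs. path_in t (xs @ [u, v]) \<and> hd (xs @ [u, v]) = r)"

definition leaf :: "'a graph \<Rightarrow> 'a \<Rightarrow> 'a \<Rightarrow> bool" where
  "leaf t r v \<longleftrightarrow> v \<in> verts t \<and> v \<noteq> r \<and> (\<nexists>w. parent t r v w)"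

definition leaf_edge :: "'a graph \<Rightarrow> 'a \<Rightarrow> 'a set \<Rightarrow> 'a \<Rightarrow> 'a \<Rightarrow> bool" where
  "leaf_edge t r e e1 e2 \<longleftrightarrow>
     e = {e1, e2} \<and> e \<in> edges t \<and> parent t r e1 e2 \<and> leaf t r e2"

definition add_edge :: "'a graph \<Rightarrow> 'a set \<Rightarrow> 'a graph" where
  "add_edge t e =
     (if e \<inter> verts t \<noteq> {} then Graph (verts t \<union> e) (insert e (edges t)) else t)"

definition remove_leaf_edge :: "'a \<Rightarrow> 'a graph \<Rightarrow> 'a set \<Rightarrow> 'a graph" where
  "remove_leaf_edge r t e =
     (if \<exists>e1 e2. leaf_edge t r e e1 e2
      then Graph (verts t - {THE e2. \<exists>e1. leaf_edge t r e e1 e2}) (edges t - {e})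
      else t)"

definition step :: "'a \<Rightarrow> 'a graph \<Rightarrow> 'a set \<Rightarrow> int \<Rightarrow> 'a graph" where
  "step r t e c =
     (if c = 1 then add_edge t e else if c = - 1 then remove_leaf_edge r t e else t)"

text \<open>The arguments \<open>p\<close>, \<open>q\<close>, \<open>s\<close> are the probabilities of adding, doing nothing and removing
  (\<open>s\<close> because \<open>r\<close> is the root).  The value is meaningful when the edge set of \<open>T\<close> is finite
  and nonempty and \<open>p\<close>, \<open>q\<close>, \<open>s\<close> at the size of \<open>t\<close> are nonnegative with sum 1.\<close>

definition subtree_kernel ::
  "'a graph \<Rightarrow> 'a \<Rightarrow> (nat \<Rightarrow> real) \<Rightarrow> (nat \<Rightarrow> real) \<Rightarrow> (nat \<Rightarrow> real) \<Rightarrow> 'a graph \<Rightarrow> 'a graph pmf"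
where
  "subtree_kernel T r p q s t =
     bind_pmf (pmf_of_set (edges T)) (\<lambda>e.
       bind_pmf (pmf_of_list [(1, p (card (verts t))), (0, q (card (verts t))),
                              (- 1, s (card (verts t)))]) (\<lambda>c.
         return_pmf (step r t e c)))"

definition invariant_distribution :: "'b set \<Rightarrow> ('b \<Rightarrow> 'b pmf) \<Rightarrow> 'b pmf \<Rightarrow> bool" where
  "invariant_distribution S K \<mu> \<longleftrightarrow> set_pmf \<mu> \<subseteq> S \<and> bind_pmf \<mu> K = \<mu>"

end

theory Submission
  imports Defs
begin

text \<open>
  The chain is reversible.  Adding an edge \<open>e\<close> and pruning \<open>e\<close> are mutually inverse moves: for distinct
  rooted subtrees \<open>t\<close> and \<open>t'\<close>, the edge \<open>e\<close> takes \<open>t\<close> to \<open>t'\<close> by growth iff it takes \<open>t'\<close> back to \<open>t\<close>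
  by pruning (\<open>add_edge_iff_remove_leaf_edge\<close>), and then \<open>t'\<close> has exactly one vertex more.  Since \<open>e\<close> is
  drawn uniformly and independently of the sign, these two moves have probabilities proportional to
  \<open>p |t|\<close> and \<open>s (|t| + 1)\<close> with the same factor.  A weight that depends only on the number \<open>m\<close> of
  vertices therefore satisfies detailed balance as soon as
  \<open>weight (m + 1) * s (m + 1) = weight m * p m\<close>, which is solved by the product in the theorem; its
  normalisation is an invariant distribution.

  Uniqueness cannot be read off from irreducibility, because some of the \<open>p i\<close> may vanish.  However,
  pruning always has positive probability and every tree other than the single root has a prunable
  leaf (\<open>exists_pruning\<close>), so the single root is reachable from every state.  One state reachable from
  everywhere is enough for uniqueness on a finite state space (\<open>invariant_unique_if_reachable\<close>).

  The combinatorial part rests on the fact that a subtree of \<open>T\<close> contains every edge of \<open>T\<close> between two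
  of its vertices (\<open>subtree_edge_if_subset_verts\<close>), since otherwise that edge would close a cycle.
  So subtrees are determined by their vertex sets, and a growth move either changes nothing or
  attaches exactly one new vertex, which is then a leaf.
\<close>

section \<open>Invariant distributions on a finite state space\<close>

lemma invariant_distribution_iff_finite:
  assumes "finite S" "\<And>x. x \<in> S \<Longrightarrow> set_pmf (K x) \<subseteq> S"
  shows "invariant_distribution S K \<mu> \<longleftrightarrow>
    set_pmf \<mu> \<subseteq> S \<and> (\<forall>y\<in>S. pmf \<mu> y = (\<Sum>x\<in>S. pmf \<mu> x * pmf (K x) y))"
proof -
  have eq: "pmf (bind_pmf \<mu> K) y = (\<Sum>x\<in>S. pmf \<mu> x * pmf (K x) y)" if "set_pmf \<mu> \<subseteq> S" for y
    unfolding pmf_bind using that assms(1)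
    by (subst integral_measure_pmf_real[where A = S]) (auto simp: mult.commute)
  have out: "pmf (bind_pmf \<mu> K) y = pmf \<mu> y" if "set_pmf \<mu> \<subseteq> S" "y \<notin> S" for y
  proof -
    have "y \<notin> set_pmf \<mu>" "y \<notin> set_pmf (bind_pmf \<mu> K)"
      using that assms(2) by (auto simp: set_bind_pmf)
    then show ?thesis by (simp add: set_pmf_eq)
  qed
  show ?thesis
    unfolding invariant_distribution_def using eq out by (metis pmf_eqI)
qed

lemma invariant_if_reversible:
  assumes "finite S" "\<And>x. x \<in> S \<Longrightarrow> set_pmf (K x) \<subseteq> S" "set_pmf \<mu> \<subseteq> S"
    and rev: "\<And>x y. x \<in> S \<Longrightarrow> y \<in> S \<Longrightarrow> pmf \<mu> x * pmf (K x) y = pmf \<mu> y * pmf (K y) x"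
  shows "invariant_distribution S K \<mu>"
proof -
  have "(\<Sum>x\<in>S. pmf \<mu> x * pmf (K x) y) = pmf \<mu> y" if "y \<in> S" for y
  proof -
    have "(\<Sum>x\<in>S. pmf \<mu> x * pmf (K x) y) = pmf \<mu> y * (\<Sum>x\<in>S. pmf (K y) x)"
      unfolding sum_distrib_left using rev that by (intro sum.cong) auto
    then show ?thesis using assms(1,2) that by (simp add: sum_pmf_eq_1)
  qed
  then show ?thesis using assms(1-3) by (simp add: invariant_distribution_iff_finite)
qed

text \<open>
  Take invariant \<open>m\<close> and \<open>m'\<close> with \<open>m x0 \<le> m' x0\<close>, and let \<open>g\<close> be the positive part of \<open>m - m'\<close>.
  Positive parts are subinvariant, and as the kernel preserves total mass \<open>g\<close> is in fact invariant.
  It vanishes at \<open>x0\<close>, and an invariant nonnegative function that vanishes at a state vanishes at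
  all predecessors of that state, hence everywhere.  So \<open>m \<le> m'\<close> pointwise, and equality follows
  from equal total masses.
\<close>

lemma invariant_unique_if_reachable:
  assumes fin: "finite S" and K: "\<And>x. x \<in> S \<Longrightarrow> set_pmf (K x) \<subseteq> S"
    and reach: "\<And>x. x \<in> S \<Longrightarrow> (x, x0) \<in> {(x, y). y \<in> set_pmf (K x)}\<^sup>*"
    and x0: "x0 \<in> S"
    and inv: "invariant_distribution S K \<mu>" "invariant_distribution S K \<mu>'"
  shows "\<mu> = \<mu>'"
proof -
  have le: "pmf m x \<le> pmf m' x"
    if m: "invariant_distribution S K m" and m': "invariant_distribution S K m'"
      and le0: "pmf m x0 \<le> pmf m' x0" and x: "x \<in> S" for m m' x
  proof -
    define f where "f x = pmf m x - pmf m' x" for x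
    define g where "g x = max (f x) 0" for x
    have f_inv: "f y = (\<Sum>x\<in>S. f x * pmf (K x) y)" if "y \<in> S" for y
      using m m' that unfolding f_def
      by (simp add: invariant_distribution_iff_finite[OF fin K] left_diff_distrib sum_subtractf)
    have g_le: "g y \<le> (\<Sum>x\<in>S. g x * pmf (K x) y)" if "y \<in> S" for y
    proof -
      have "f y \<le> (\<Sum>x\<in>S. g x * pmf (K x) y)"
        unfolding f_inv[OF that] by (intro sum_mono mult_right_mono) (auto simp: g_def)
      moreover have "0 \<le> (\<Sum>x\<in>S. g x * pmf (K x) y)"
        by (intro sum_nonneg mult_nonneg_nonneg) (auto simp: g_def)
      ultimately show ?thesis by (simp add: g_def)
    qed
    \<comment> \<open>Both sides of the subinvariance inequality have the same sum over \<open>S\<close>, so it is an equality.\<close>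
    have "(\<Sum>y\<in>S. \<Sum>x\<in>S. g x * pmf (K x) y) = (\<Sum>x\<in>S. g x * (\<Sum>y\<in>S. pmf (K x) y))"
      unfolding sum_distrib_left by (rule sum.swap)
    also have "\<dots> = (\<Sum>x\<in>S. g x)"
      using fin K by (intro sum.cong) (auto simp: sum_pmf_eq_1)
    finally have "(\<Sum>y\<in>S. (\<Sum>x\<in>S. g x * pmf (K x) y) - g y) = 0"
      by (simp add: sum_subtractf)
    then have g_inv: "g y = (\<Sum>x\<in>S. g x * pmf (K x) y)" if "y \<in> S" for y
      using sum_nonneg_eq_0_iff[OF fin, of "\<lambda>y. (\<Sum>x\<in>S. g x * pmf (K x) y) - g y"] g_le that
      by auto
    have g_zero_pred: "g x = 0" if "x \<in> S" "y \<in> S" "y \<in> set_pmf (K x)" "g y = 0" for x y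
    proof -
      have "(\<Sum>x\<in>S. g x * pmf (K x) y) = 0"
        using g_inv[OF that(2)] that(4) by simp
      then have "g x * pmf (K x) y = 0"
        using that(1) fin by (subst (asm) sum_nonneg_eq_0_iff) (auto simp: g_def)
      then show ?thesis using that(3) by (simp add: set_pmf_eq)
    qed
    have "x \<in> S \<longrightarrow> g x = 0"
      using reach[OF x]
    proof (induction rule: converse_rtrancl_induct)
      case base
      then show ?case using le0 by (simp add: g_def f_def)
    next
      case (step x y)
      then show ?case using g_zero_pred K by blast
    qed
    then show ?thesis using x by (simp add: g_def f_def max_def split: if_splits)
  qed
  have eq: "m = m'"
    if m: "invariant_distribution S K m" and m': "invariant_distribution S K m'"
      and le0: "pmf m x0 \<le> pmf m' x0" for m m'
  proof (rule pmf_eqI)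
    fix x
    have sub: "set_pmf m \<subseteq> S" "set_pmf m' \<subseteq> S"
      using m m' by (auto simp: invariant_distribution_def)
    have "(\<Sum>x\<in>S. pmf m' x - pmf m x) = 0"
      using fin sub by (simp add: sum_subtractf sum_pmf_eq_1)
    then have "\<forall>x\<in>S. pmf m' x - pmf m x = 0"
      using sum_nonneg_eq_0_iff[OF fin, of "\<lambda>x. pmf m' x - pmf m x"] le[OF m m' le0] by auto
    moreover have "x \<notin> S \<Longrightarrow> pmf m x = 0 \<and> pmf m' x = 0"
      using sub by (auto simp: set_pmf_eq)
    ultimately show "pmf m x = pmf m' x" by (cases "x \<in> S") auto
  qed
  show ?thesis
    using eq inv by (cases "pmf \<mu> x0 \<le> pmf \<mu>' x0") (auto intro: sym)
qed

lemma pmf_of_finite_weights: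
  fixes w :: "'b \<Rightarrow> real"
  assumes "finite S" "\<And>x. x \<in> S \<Longrightarrow> 0 \<le> w x" "(\<Sum>x\<in>S. w x) = 1"
  obtains \<mu> where "\<And>x. pmf \<mu> x = w x * indicator S x"
proof
  let ?f = "\<lambda>x. w x * indicator S x"
  fix x
  show "pmf (embed_pmf ?f) x = ?f x"
  proof (rule pmf_embed_pmf)
    show "0 \<le> ?f x" for x using assms(2) by (auto simp: indicator_def)
    have "(\<integral>\<^sup>+x. ennreal (?f x) \<partial>count_space UNIV) = (\<Sum>x\<in>S. ennreal (?f x))"
      using assms(1) by (intro nn_integral_count_space') auto
    also have "\<dots> = ennreal (\<Sum>x\<in>S. w x)"
      using assms(2) by (subst sum_ennreal[symmetric]) auto
    finally show "(\<integral>\<^sup>+x. ennreal (?f x) \<partial>count_space UNIV) = 1"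
      using assms(3) by simp
  qed
qed

section \<open>Subtrees of a tree\<close>

lemma path_in_mono:
  assumes "path_in t xs" "verts t \<subseteq> verts G" "edges t \<subseteq> edges G"
  shows "path_in G xs"
proof -
  have "successively (\<lambda>u v. {u, v} \<in> edges G) xs"
    using assms(1,3) unfolding path_in_def by (blast intro: successively_mono)
  then show ?thesis using assms(1,2) by (auto simp: path_in_def)
qed

text \<open>
  Only connectedness has to be established for a subgraph: a cycle in it would be a cycle in \<open>T\<close>.
\<close>

lemma subtreeI:
  assumes "finite_tree T" "verts t \<subseteq> verts T" "edges t \<subseteq> edges T"
    and "\<And>e. e \<in> edges t \<Longrightarrow> e \<subseteq> verts t" "connected_graph t"
  shows "subtree t T"
proof -
  have "\<not> cycle_in t xs" for xs
    using assms(1-3) path_in_mono[of t xs T] unfolding finite_tree_def cycle_in_def by blast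
  then show ?thesis
    using assms
    by (auto simp: subtree_def finite_tree_def finite_simple_graph_def intro: finite_subset)
qed

lemma finite_tree_edge_cases:
  assumes "finite_tree T" "e \<in> edges T"
  obtains u v where "e = {u, v}" "u \<noteq> v" "u \<in> verts T" "v \<in> verts T"
proof -
  have "card e = 2" "e \<subseteq> verts T"
    using assms by (auto simp: finite_tree_def finite_simple_graph_def)
  then show thesis using that by (auto simp: card_2_iff)
qed

lemma finite_tree_path:
  assumes "finite_tree t" "u \<in> verts t" "v \<in> verts t"
  shows "\<exists>xs. path_in t xs \<and> hd xs = u \<and> last xs = v"
  using assms unfolding finite_tree_def connected_graph_def by blast

text \<open>
  If an edge \<open>e\<close> of \<open>T\<close> between two vertices of the subtree \<open>t\<close> were missing from \<open>t\<close>, the path in \<open>t\<close>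
  between its ends would have at least three vertices and \<open>e\<close> would close it to a cycle of \<open>T\<close>.
\<close>

lemma subtree_edge_if_subset_verts:
  assumes T: "finite_tree T" and t: "subtree t T" and e: "e \<in> edges T" "e \<subseteq> verts t"
  shows "e \<in> edges t"
proof (rule ccontr)
  assume nin: "e \<notin> edges t"
  obtain u v where uv: "e = {u, v}" "u \<noteq> v"
    using finite_tree_edge_cases[OF T e(1)] by metis
  obtain xs where xs: "path_in t xs" "hd xs = u" "last xs = v"
    using finite_tree_path[of t u v] t e(2) uv(1) by (auto simp: subtree_def)
  have "length xs \<ge> 3"
  proof (rule ccontr)
    assume "\<not> 3 \<le> length xs"
    then consider "xs = []" | a where "xs = [a]" | a b where "xs = [a, b]"
      by (cases xs rule: remdups_adj.cases) (auto simp: Suc_le_eq)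
    then show False using xs nin uv by cases (auto simp: path_in_def)
  qed
  moreover have "path_in T xs"
    using xs(1) t by (auto simp: subtree_def intro: path_in_mono)
  ultimately have "cycle_in T xs"
    using xs e(1) uv(1) by (simp add: cycle_in_def insert_commute)
  then show False using T by (auto simp: finite_tree_def)
qed

lemma edge_subset_verts: "subtree t T \<Longrightarrow> e \<in> edges t \<Longrightarrow> e \<subseteq> verts t"
  by (auto simp: subtree_def finite_tree_def finite_simple_graph_def)

lemma subtree_eqI:
  assumes "finite_tree T" "subtree t T" "subtree t' T" "verts t = verts t'"
  shows "t = t'"
proof -
  have "edges x = {e \<in> edges T. e \<subseteq> verts x}" if "subtree x T" for x
    using that edge_subset_verts subtree_edge_if_subset_verts[OF assms(1)]
    by (fastforce simp: subtree_def)
  then show ?thesis using assms(2-4) by (intro graph.expand) auto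
qed

lemma rooted_subtrees_iff: "t \<in> rooted_subtrees T r \<longleftrightarrow> subtree t T \<and> r \<in> verts t"
  by (auto simp: rooted_subtrees_def rooted_subtrees_of_size_def)

lemma finite_rooted_subtrees:
  assumes "finite_tree T"
  shows "finite (rooted_subtrees T r)"
proof (rule inj_on_finite[of verts])
  show "inj_on verts (rooted_subtrees T r)"
    using subtree_eqI[OF assms] by (auto simp: inj_on_def rooted_subtrees_iff)
  show "verts ` rooted_subtrees T r \<subseteq> Pow (verts T)"
    by (auto simp: rooted_subtrees_iff subtree_def)
  show "finite (Pow (verts T))"
    using assms by (auto simp: finite_tree_def finite_simple_graph_def)
qed

lemma root_only_in_rooted_subtrees:
  assumes "finite_tree T" "r \<in> verts T"
  shows "Graph {r} {} \<in> rooted_subtrees T r"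
proof -
  have "path_in (Graph {r} {}) [r]" by (simp add: path_in_def)
  then have "connected_graph (Graph {r} {})"
    unfolding connected_graph_def by force
  then show ?thesis using assms by (auto simp: rooted_subtrees_iff intro!: subtreeI)
qed

text \<open>
  An interior vertex of a path has two distinct neighbours on it, hence lies on two distinct edges.
  This controls paths near the vertex that is attached or pruned, in both directions.
\<close>

lemma path_avoids_pendant_vertex:
  assumes path: "path_in G xs" and b: "b \<noteq> hd xs" "b \<noteq> last xs"
    and pendant: "\<And>f. f \<in> edges G \<Longrightarrow> b \<in> f \<Longrightarrow> f = e"
  shows "b \<notin> set xs"
proof
  assume "b \<in> set xs"
  then obtain ys zs where xs: "xs = ys @ b # zs" by (meson split_list)
  have ne: "ys \<noteq> []" "zs \<noteq> []" using b xs by auto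
  have "{last ys, b} \<in> edges G" "{b, hd zs} \<in> edges G"
    using path ne unfolding xs path_in_def
    by (auto simp: successively_append_iff successively_Cons)
  then have "{last ys, b} = {b, hd zs}" using pendant by (metis insertCI)
  moreover have "last ys \<in> set ys" "hd zs \<in> set zs" using ne by auto
  ultimately show False
    using path unfolding xs path_in_def by (auto simp: doubleton_eq_iff)
qed

lemma connected_graph_exit_edge:
  assumes "connected_graph G" "A \<inter> verts G \<noteq> {}" "\<not> verts G \<subseteq> A"
  obtains u v where "{u, v} \<in> edges G" "u \<in> A" "v \<in> verts G" "v \<notin> A"
proof -
  obtain x y where "x \<in> A" "x \<in> verts G" "y \<in> verts G" "y \<notin> A" using assms(2,3) by blast
  then obtain xs where xs: "path_in G xs" "hd xs \<in> A" "last xs \<notin> A"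
    using assms(1) unfolding connected_graph_def by metis
  have "xs \<noteq> [] \<Longrightarrow> successively (\<lambda>u v. {u, v} \<in> edges G) xs \<Longrightarrow> set xs \<subseteq> verts G \<Longrightarrow>
      hd xs \<in> A \<Longrightarrow> last xs \<notin> A \<Longrightarrow> \<exists>u v. {u, v} \<in> edges G \<and> u \<in> A \<and> v \<in> verts G \<and> v \<notin> A"
  proof (induction xs rule: induct_list012)
    case (3 x y zs)
    then show ?case by (cases "y \<in> A") auto
  qed auto
  then show thesis using xs that unfolding path_in_def by blast
qed

section \<open>Adding an edge and pruning a leaf\<close>

text \<open>
  The parent relation orients an edge: with the ends swapped, the supposed leaf would be a parent.
  This makes the definite description in \<open>remove_leaf_edge\<close> well defined.
\<close>

lemma leaf_edge_unique:
  assumes "leaf_edge t r e a b" "leaf_edge t r e c d"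
  shows "d = b"
  using assms unfolding leaf_edge_def leaf_def by (auto simp: doubleton_eq_iff)

lemma remove_leaf_edge_eq:
  assumes "leaf_edge t r e a b"
  shows "remove_leaf_edge r t e = Graph (verts t - {b}) (edges t - {e})"
proof -
  have "(THE d. \<exists>c. leaf_edge t r e c d) = b"
    using assms by (intro the_equality) (auto dest: leaf_edge_unique)
  then show ?thesis using assms unfolding remove_leaf_edge_def by auto
qed

lemma add_edge_eq_self:
  assumes "finite_tree T" "subtree t T" "e \<in> edges T" "e \<subseteq> verts t"
  shows "add_edge t e = t"
  using subtree_edge_if_subset_verts[OF assms] assms(4)
  by (cases t) (auto simp: add_edge_def insert_absorb Un_absorb2)

text \<open>
  The new vertex \<open>v\<close> is pendant in \<open>t'\<close>.  Hence no path from the root passes through \<open>v\<close>, so \<open>v\<close> is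
  a leaf, and extending a path from the root to \<open>u\<close> shows that its parent is \<open>u\<close>.
\<close>

lemma add_edge_new_vertex:
  assumes T: "finite_tree T" and t: "t \<in> rooted_subtrees T r"
    and e: "{u, v} \<in> edges T" and u: "u \<in> verts t" and v: "v \<notin> verts t"
  defines "t' \<equiv> Graph (insert v (verts t)) (insert {u, v} (edges t))"
  shows "add_edge t {u, v} = t'"
    and "t' \<in> rooted_subtrees T r"
    and "remove_leaf_edge r t' {u, v} = t"
proof -
  have st: "subtree t T" and r: "r \<in> verts t" using t by (auto simp: rooted_subtrees_iff)
  show add: "add_edge t {u, v} = t'"
    using u unfolding add_edge_def t'_def by auto
  have conn: "\<exists>xs. path_in t xs \<and> hd xs = x \<and> last xs = y"
    if "x \<in> verts t" "y \<in> verts t" for x y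
    using st that by (simp add: subtree_def finite_tree_path)
  have lift: "path_in t' xs" if "path_in t xs" for xs
    using that by (rule path_in_mono) (auto simp: t'_def)
  have append: "path_in t' (xs @ [v])" if "path_in t xs" "last xs = u" for xs
    using lift[OF that(1)] that v unfolding path_in_def t'_def
    by (auto simp: successively_append_iff)
  have prepend: "path_in t' (v # xs)" if "path_in t xs" "hd xs = u" for xs
    using lift[OF that(1)] that v unfolding path_in_def t'_def
    by (auto simp: successively_Cons insert_commute)
  have "\<exists>xs. path_in t' xs \<and> hd xs = x \<and> last xs = y" if xy: "x \<in> verts t'" "y \<in> verts t'" for x y
  proof -
    consider "x \<in> verts t" "y \<in> verts t" | "x = v" "y \<in> verts t" | "x \<in> verts t" "y = v"
      | "x = v" "y = v"
      using xy by (auto simp: t'_def)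
    then show ?thesis
    proof cases
      case 1
      then show ?thesis using conn lift by blast
    next
      case 2
      then obtain xs where "path_in t xs" "hd xs = u" "last xs = y" using conn u by blast
      then show ?thesis using prepend[of xs] 2 by (intro exI[of _ "v # xs"]) (auto simp: path_in_def)
    next
      case 3
      then obtain xs where "path_in t xs" "hd xs = x" "last xs = u" using conn u by blast
      then show ?thesis using append[of xs] 3 by (intro exI[of _ "xs @ [v]"]) (auto simp: path_in_def)
    next
      case 4
      then show ?thesis by (intro exI[of _ "[v]"]) (auto simp: path_in_def t'_def)
    qed
  qed
  then have "connected_graph t'" by (auto simp: connected_graph_def t'_def)
  moreover have "verts t' \<subseteq> verts T" "edges t' \<subseteq> edges T"
    using T e st by (auto simp: finite_tree_def finite_simple_graph_def subtree_def t'_def)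
  moreover have "f \<subseteq> verts t'" if "f \<in> edges t'" for f
    using that edge_subset_verts[OF st] u by (auto simp: t'_def)
  ultimately show t': "t' \<in> rooted_subtrees T r"
    using subtreeI[OF T, of t'] r by (auto simp: rooted_subtrees_iff t'_def)
  have pendant: "f = {u, v}" if "f \<in> edges t'" "v \<in> f" for f
    using that v edge_subset_verts[OF st] by (auto simp: t'_def)
  obtain xs where xs: "path_in t xs" "hd xs = r" "last xs = u" using conn r u by blast
  then have "xs \<noteq> []" "xs @ [v] = butlast xs @ [u, v]"
    using append_butlast_last_id[of xs] by (auto simp: path_in_def)
  then have "path_in t' (butlast xs @ [u, v])" "hd (butlast xs @ [u, v]) = r"
    using append[of xs] xs by (metis, metis hd_append2)
  then have par: "parent t' r u v" unfolding parent_def by blast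
  have "\<not> parent t' r v w" for w
  proof
    assume "parent t' r v w"
    then obtain ys where ys: "path_in t' (ys @ [v, w])" "hd (ys @ [v, w]) = r"
      unfolding parent_def by blast
    have "v \<noteq> last (ys @ [v, w])" using ys(1) by (auto simp: path_in_def)
    moreover have "v \<noteq> hd (ys @ [v, w])" using ys(2) r v by auto
    ultimately show False
      using path_avoids_pendant_vertex[OF ys(1), of v "{u, v}"] pendant by auto
  qed
  then have "leaf_edge t' r {u, v} u v"
    using par r v unfolding leaf_edge_def leaf_def by (auto simp: t'_def)
  moreover have "{u, v} \<notin> edges t" using edge_subset_verts[OF st] v by auto
  ultimately show "remove_leaf_edge r t' {u, v} = t"
    using v by (cases t) (auto simp: remove_leaf_edge_eq t'_def)
qed

text \<open>
  A leaf is only defined as a vertex without children, so it must be shown to have degree one.  Given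
  another neighbour \<open>w\<close> of \<open>b\<close>, follow the path from the root to \<open>b\<close>: if it already visits \<open>w\<close> there is
  a cycle, and otherwise it extends to \<open>w\<close>, making \<open>w\<close> a child of \<open>b\<close>.
\<close>

lemma leaf_edge_pendant:
  assumes t: "finite_tree t" and le: "leaf_edge t r e a b" and f: "f \<in> edges t" "b \<in> f"
  shows "f = e"
proof (rule ccontr)
  assume "f \<noteq> e"
  have e: "e = {a, b}" and leaf: "\<not> parent t r b w" for w
    using le by (auto simp: leaf_edge_def leaf_def)
  obtain xs where xs: "path_in t (xs @ [a, b])" "hd (xs @ [a, b]) = r"
    using le unfolding leaf_edge_def parent_def by blast
  obtain w where w: "f = {b, w}" "w \<noteq> b" "w \<in> verts t"
    using finite_tree_edge_cases[OF t f(1)] f(2) by (metis insertE insert_commute singletonD)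
  then have "w \<noteq> a" using \<open>f \<noteq> e\<close> e by auto
  show False
  proof (cases "w \<in> set xs")
    case True
    then obtain ys zs where "xs = ys @ w # zs" by (meson split_list)
    then have "path_in t (w # zs @ [a, b])"
      using xs(1) unfolding path_in_def by (auto simp: successively_append_iff)
    then have "cycle_in t (w # zs @ [a, b])" using f(1) w(1) by (simp add: cycle_in_def)
    then show False using t by (auto simp: finite_tree_def)
  next
    case False
    then have "path_in t ((xs @ [a]) @ [b, w])"
      using xs(1) w f(1) \<open>w \<noteq> a\<close> unfolding path_in_def by (auto simp: successively_append_iff)
    moreover have "hd ((xs @ [a]) @ [b, w]) = r" using xs(2) by (cases xs) auto
    ultimately show False using leaf unfolding parent_def by blast
  qed
qed

lemma remove_leaf_edge_pruned:
  assumes T: "finite_tree T" and t: "t \<in> rooted_subtrees T r" and le: "leaf_edge t r e a b"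
  defines "t' \<equiv> Graph (verts t - {b}) (edges t - {e})"
  shows "t' \<in> rooted_subtrees T r" and "add_edge t' e = t"
proof -
  have st: "subtree t T" and r: "r \<in> verts t" using t by (auto simp: rooted_subtrees_iff)
  have ft: "finite_tree t" using st by (simp add: subtree_def)
  have e: "e = {a, b}" "e \<in> edges t" "b \<noteq> r" using le by (auto simp: leaf_edge_def leaf_def)
  have "a \<noteq> b" using le by (auto simp: leaf_edge_def parent_def path_in_def)
  have ab: "a \<in> verts t" "b \<in> verts t" using edge_subset_verts[OF st e(2)] e(1) by auto
  have pendant: "f = e" if "f \<in> edges t" "b \<in> f" for f
    using leaf_edge_pendant[OF ft le] that .
  have "\<exists>xs. path_in t' xs \<and> hd xs = x \<and> last xs = y" if "x \<in> verts t'" "y \<in> verts t'" for x y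
  proof -
    have xy: "x \<in> verts t" "y \<in> verts t" "x \<noteq> b" "y \<noteq> b" using that by (auto simp: t'_def)
    then obtain xs where xs: "path_in t xs" "hd xs = x" "last xs = y"
      using finite_tree_path[OF ft] by blast
    have b: "b \<notin> set xs"
      using path_avoids_pendant_vertex[OF xs(1), of b e] xs(2,3) xy pendant by auto
    have "successively (\<lambda>u v. {u, v} \<in> edges t') xs"
    proof (rule successively_mono)
      show "successively (\<lambda>u v. {u, v} \<in> edges t) xs" using xs(1) by (simp add: path_in_def)
    qed (use b in \<open>auto simp: t'_def e(1) doubleton_eq_iff\<close>)
    then have "path_in t' xs" using xs(1) b by (auto simp: path_in_def t'_def)
    then show ?thesis using xs by blast
  qed
  then have "connected_graph t'" using r e(3) by (auto simp: connected_graph_def t'_def)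
  moreover have "verts t' \<subseteq> verts T" "edges t' \<subseteq> edges T"
    using st by (auto simp: subtree_def t'_def)
  moreover have "f \<subseteq> verts t'" if "f \<in> edges t'" for f
    using that edge_subset_verts[OF st] pendant by (auto simp: t'_def)
  ultimately show "t' \<in> rooted_subtrees T r"
    using subtreeI[OF T, of t'] r e(3) by (auto simp: rooted_subtrees_iff t'_def)
  show "add_edge t' e = t"
    using ab e \<open>a \<noteq> b\<close> by (cases t) (auto simp: add_edge_def t'_def)
qed

lemma add_edge_cases:
  assumes T: "finite_tree T" and t: "t \<in> rooted_subtrees T r" and e: "e \<in> edges T"
  obtains (same) "add_edge t e = t"
  | (grown) "add_edge t e \<in> rooted_subtrees T r" "remove_leaf_edge r (add_edge t e) e = t"
      "card (verts (add_edge t e)) = Suc (card (verts t))"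
proof -
  have st: "subtree t T" using t by (simp add: rooted_subtrees_iff)
  obtain x y where xy: "e = {x, y}" using finite_tree_edge_cases[OF T e] by metis
  consider "e \<inter> verts t = {}" | "e \<subseteq> verts t"
    | u v where "e = {u, v}" "u \<in> verts t" "v \<notin> verts t"
    using xy by (metis disjoint_insert(2) empty_subsetI inf_bot_left insert_commute insert_subset Int_commute)
  then show thesis
  proof cases
    case 1
    then show thesis using same by (simp add: add_edge_def)
  next
    case 2
    then show thesis using same add_edge_eq_self[OF T st e] by blast
  next
    case 3
    have "finite (verts t)"
      using st by (simp add: subtree_def finite_tree_def finite_simple_graph_def)
    then show thesis
      using add_edge_new_vertex[OF T t, of u v] e 3 grown by simp
  qed
qed

lemma remove_leaf_edge_cases:
  assumes T: "finite_tree T" and t: "t \<in> rooted_subtrees T r"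
  obtains (same) "remove_leaf_edge r t e = t"
  | (pruned) "remove_leaf_edge r t e \<in> rooted_subtrees T r" "add_edge (remove_leaf_edge r t e) e = t"
proof (cases "\<exists>a b. leaf_edge t r e a b")
  case True
  then obtain a b where "leaf_edge t r e a b" by blast
  then show thesis
    using remove_leaf_edge_pruned[OF T t] remove_leaf_edge_eq[of t r e a b] pruned by metis
next
  case False
  then show thesis using same by (simp add: remove_leaf_edge_def)
qed

text \<open>
  This symmetry between growing and pruning is the combinatorial source of reversibility.
\<close>

lemma add_edge_iff_remove_leaf_edge:
  assumes T: "finite_tree T" and e: "e \<in> edges T"
    and "t \<in> rooted_subtrees T r" "t' \<in> rooted_subtrees T r" "t \<noteq> t'"
  shows "add_edge t e = t' \<longleftrightarrow> remove_leaf_edge r t' e = t"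
  using assms(5) add_edge_cases[OF T assms(3) e] remove_leaf_edge_cases[OF T assms(4), of e]
  by metis

text \<open>
  Among the rooted subtrees whose vertex set is properly contained in that of \<open>t\<close>, take a largest one \<open>x\<close>.  By
  connectedness some edge of \<open>t\<close> leaves \<open>x\<close>; adding it must give all of \<open>t\<close>, so pruning that edge from
  \<open>t\<close> gives back \<open>x\<close>.
\<close>

lemma exists_pruning:
  assumes T: "finite_tree T" and t: "t \<in> rooted_subtrees T r" and ne: "t \<noteq> Graph {r} {}"
  obtains e where "e \<in> edges T" "remove_leaf_edge r t e \<in> rooted_subtrees T r"
    "card (verts (remove_leaf_edge r t e)) < card (verts t)"
proof -
  let ?S = "rooted_subtrees T r"
  define A where "A = {x \<in> ?S. verts x \<subset> verts t}"
  have st: "subtree t T" and r: "r \<in> verts t" using t by (auto simp: rooted_subtrees_iff)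
  have fin: "finite (verts t)" and conn: "connected_graph t" and rT: "r \<in> verts T"
    using st r by (auto simp: subtree_def finite_tree_def finite_simple_graph_def)
  have root: "Graph {r} {} \<in> ?S" using root_only_in_rooted_subtrees[OF T rT] .
  have "verts t \<noteq> {r}"
    using ne subtree_eqI[OF T st, of "Graph {r} {}"] root by (auto simp: rooted_subtrees_iff)
  then have "Graph {r} {} \<in> A" using root r by (auto simp: A_def)
  moreover have "finite A" using finite_rooted_subtrees[OF T] by (simp add: A_def)
  ultimately obtain x where x: "x \<in> A" and max: "\<And>y. y \<in> A \<Longrightarrow> card (verts y) \<le> card (verts x)"
    using Max_in[of "(\<lambda>y. card (verts y)) ` A"] Max_ge[of "(\<lambda>y. card (verts y)) ` A"] by fastforce
  have xS: "x \<in> ?S" and xt: "verts x \<subset> verts t" and rx: "r \<in> verts x"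
    using x by (auto simp: A_def rooted_subtrees_iff)
  obtain u v where uv: "{u, v} \<in> edges t" "u \<in> verts x" "v \<in> verts t" "v \<notin> verts x"
    using connected_graph_exit_edge[OF conn, of "verts x"] rx r xt by blast
  have uvT: "{u, v} \<in> edges T" using uv(1) st by (auto simp: subtree_def)
  define y where "y = Graph (insert v (verts x)) (insert {u, v} (edges x))"
  have y: "y \<in> ?S" "remove_leaf_edge r y {u, v} = x"
    using add_edge_new_vertex[OF T xS uvT uv(2,4)] by (auto simp: y_def)
  have "finite (verts x)" using fin xt by (auto intro: finite_subset)
  then have "card (verts y) > card (verts x)" using uv(4) by (simp add: y_def)
  then have "y \<notin> A" using max by fastforce
  then have "verts y = verts t" using y(1) xt uv(3) by (auto simp: A_def y_def)
  then have "y = t" using y(1) st subtree_eqI[OF T] by (auto simp: rooted_subtrees_iff)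
  then show thesis using that[OF uvT] y xS psubset_card_mono[OF fin xt] by simp
qed

section \<open>Detailed balance for the subtree kernel\<close>

lemma pmf_subtree_kernel:
  assumes E: "finite (edges T)" "edges T \<noteq> {}"
    and nn: "p (card (verts t)) \<ge> 0" "q (card (verts t)) \<ge> 0" "s (card (verts t)) \<ge> 0"
    and sum1: "p (card (verts t)) + q (card (verts t)) + s (card (verts t)) = 1"
  shows "pmf (subtree_kernel T r p q s t) x =
    (\<Sum>e\<in>edges T. p (card (verts t)) * of_bool (add_edge t e = x)
       + q (card (verts t)) * of_bool (t = x)
       + s (card (verts t)) * of_bool (remove_leaf_edge r t e = x)) / card (edges T)"
proof -
  let ?m = "card (verts t)"
  let ?L = "[(1, p ?m), (0, q ?m), (- 1, s ?m)] :: (int \<times> real) list"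
  have wf: "pmf_of_list_wf ?L"
    using nn sum1 by (auto simp: pmf_of_list_wf_def)
  have sub: "set_pmf (pmf_of_list ?L) \<subseteq> {1, 0, -1}"
    using set_pmf_of_list[OF wf] by auto
  have "pmf (bind_pmf (pmf_of_list ?L) (\<lambda>c. return_pmf (step r t e c))) x =
     (\<Sum>c\<in>{1, 0, -1}. pmf (return_pmf (step r t e c)) x * pmf (pmf_of_list ?L) c)" for e
    unfolding pmf_bind using sub by (subst integral_measure_pmf_real[where A = "{1, 0, -1}"]) (auto simp: mult.commute)
  also have "\<dots> e = p ?m * of_bool (add_edge t e = x) + q ?m * of_bool (t = x)
       + s ?m * of_bool (remove_leaf_edge r t e = x)" for e
    by (simp add: pmf_pmf_of_list[OF wf] step_def indicator_def)
  finally show ?thesis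
    unfolding subtree_kernel_def using E by (simp add: pmf_bind_pmf_of_set)
qed


lemma step_in_rooted_subtrees:
  assumes "finite_tree T" "t \<in> rooted_subtrees T r" "e \<in> edges T"
  shows "step r t e c \<in> rooted_subtrees T r"
proof -
  have "add_edge t e \<in> rooted_subtrees T r"
    using add_edge_cases[OF assms] assms(2) by metis
  moreover have "remove_leaf_edge r t e \<in> rooted_subtrees T r"
    using remove_leaf_edge_cases[OF assms(1,2), of e] assms(2) by metis
  ultimately show ?thesis using assms(2) by (simp add: step_def)
qed

locale lazy_subtree_walk =
  fixes T :: "'a graph" and r :: 'a and p q s :: "nat \<Rightarrow> real"
  assumes tree: "finite_tree T"
    and two_verts: "card (verts T) \<ge> 2"
    and root: "r \<in> verts T"
    and probs: "\<And>i. i \<in> {1..card (verts T)} \<Longrightarrow> p i \<ge> 0 \<and> q i \<ge> 0 \<and> s i \<ge> 0 \<and> p i + q i + s i = 1"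
    and prune_pos: "\<And>i. i \<in> {1..card (verts T)} \<Longrightarrow> s i > 0"
begin

abbreviation "S \<equiv> rooted_subtrees T r"
abbreviation "K \<equiv> subtree_kernel T r p q s"

definition weight :: "nat \<Rightarrow> real" where
  "weight m = (\<Prod>i=2..m. p (i - 1) / s i)"

lemma finite_verts: "finite (verts T)"
  using tree by (auto simp: finite_tree_def finite_simple_graph_def)

lemma finite_edges: "finite (edges T)"
proof (rule finite_subset)
  show "edges T \<subseteq> Pow (verts T)" using tree by (auto simp: finite_tree_def finite_simple_graph_def)
qed (simp add: finite_verts)

lemma edges_nonempty: "edges T \<noteq> {}"
proof -
  have "\<not> verts T \<subseteq> {r}" using two_verts card_mono[of "{r}" "verts T"] by auto
  moreover have "connected_graph T" using tree by (simp add: finite_tree_def)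
  ultimately show ?thesis
    using connected_graph_exit_edge[of T "{r}"] root by blast
qed

lemma card_verts_rooted_subtree: "t \<in> S \<Longrightarrow> card (verts t) \<in> {1..card (verts T)}"
proof -
  assume "t \<in> S"
  then have "verts t \<subseteq> verts T" "r \<in> verts t" by (auto simp: rooted_subtrees_iff subtree_def)
  then show ?thesis using finite_verts card_mono[OF finite_verts, of "verts t"]
    by (auto simp: Suc_le_eq card_gt_0_iff intro: finite_subset)
qed

lemma pmf_kernel:
  assumes "t \<in> S"
  shows "pmf (K t) x =
    (\<Sum>e\<in>edges T. p (card (verts t)) * of_bool (add_edge t e = x)
       + q (card (verts t)) * of_bool (t = x)
       + s (card (verts t)) * of_bool (remove_leaf_edge r t e = x)) / card (edges T)"
  using probs[OF card_verts_rooted_subtree[OF assms]] finite_edges edges_nonempty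
  by (intro pmf_subtree_kernel) auto

lemma kernel_closed: "t \<in> S \<Longrightarrow> set_pmf (K t) \<subseteq> S"
  using step_in_rooted_subtrees[OF tree] finite_edges edges_nonempty
  by (auto simp: subtree_kernel_def set_bind_pmf set_pmf_of_set)

text \<open>The two moves along an edge between \<open>t\<close> and \<open>t'\<close> carry the same flow.\<close>

lemma weight_balance:
  assumes "t \<in> S" "t' \<in> S" "card (verts t') = Suc (card (verts t))"
  shows "weight (card (verts t)) * p (card (verts t)) = weight (card (verts t')) * s (card (verts t'))"
proof -
  have "weight (Suc m) = weight m * (p m / s (Suc m))" if "m \<ge> 1" for m
    using that by (simp add: weight_def)
  then show ?thesis
    using card_verts_rooted_subtree assms prune_pos[of "card (verts t')"] by force
qed

lemma kernel_reversible:
  assumes S: "t \<in> S" "t' \<in> S"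
  shows "weight (card (verts t)) * pmf (K t) t' = weight (card (verts t')) * pmf (K t') t"
proof (cases "t = t'")
  case False
  \<comment> \<open>Each growth term on one side is matched with the pruning term for the same edge on the other.\<close>
  have half: "weight (card (verts x)) * p (card (verts x)) * of_bool (add_edge x e = y)
      = weight (card (verts y)) * s (card (verts y)) * of_bool (remove_leaf_edge r y e = x)"
    if "x \<in> S" "y \<in> S" "x \<noteq> y" "e \<in> edges T" for x y e
  proof (cases "add_edge x e = y")
    case True
    then have "card (verts y) = Suc (card (verts x))"
      using add_edge_cases[OF tree that(1,4)] that(3) by metis
    then show ?thesis
      using True weight_balance add_edge_iff_remove_leaf_edge[OF tree] that by simp
  next
    case F: False
    then show ?thesis using add_edge_iff_remove_leaf_edge[OF tree] that by simp
  qed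
  have "weight (card (verts t)) * (p (card (verts t)) * of_bool (add_edge t e = t')
       + q (card (verts t)) * of_bool (t = t')
       + s (card (verts t)) * of_bool (remove_leaf_edge r t e = t')) =
    weight (card (verts t')) * (p (card (verts t')) * of_bool (add_edge t' e = t)
       + q (card (verts t')) * of_bool (t' = t)
       + s (card (verts t')) * of_bool (remove_leaf_edge r t' e = t))" if "e \<in> edges T" for e
    using half[OF S False that] half[OF S(2,1) _ that] False by (simp add: algebra_simps)
  then show ?thesis
    by (simp add: pmf_kernel S sum_distrib_left cong: sum.cong)
qed simp

text \<open>Successive prunings, each of positive probability because \<open>s\<close> is, lead down to the single root.\<close>

lemma kernel_reaches_root:
  assumes "t \<in> S"
  shows "(t, Graph {r} {}) \<in> {(x, y). y \<in> set_pmf (K x)}\<^sup>*"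
  using assms
proof (induction "card (verts t)" arbitrary: t rule: less_induct)
  case less
  show ?case
  proof (cases "t = Graph {r} {}")
    case False
    then obtain e where e: "e \<in> edges T" and y: "remove_leaf_edge r t e \<in> S"
        "card (verts (remove_leaf_edge r t e)) < card (verts t)"
      using exists_pruning[OF tree less.prems] by blast
    let ?y = "remove_leaf_edge r t e" and ?m = "card (verts t)"
    note pr = probs[OF card_verts_rooted_subtree[OF less.prems]]
      prune_pos[OF card_verts_rooted_subtree[OF less.prems]]
    have "0 < (\<Sum>e\<in>edges T. p ?m * of_bool (add_edge t e = ?y) + q ?m * of_bool (t = ?y)
       + s ?m * of_bool (remove_leaf_edge r t e = ?y))"
      using pr e finite_edges by (intro sum_pos2[of _ e]) (auto intro!: add_nonneg_pos)
    then have "?y \<in> set_pmf (K t)"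
      using finite_edges edges_nonempty
      by (simp add: set_pmf_iff pmf_kernel[OF less.prems] card_gt_0_iff)
    then show ?thesis
      using less.hyps[OF y(2,1)] by (auto intro: converse_rtrancl_into_rtrancl)
  qed simp
qed

lemma weight_nonneg:
  assumes "t \<in> S"
  shows "weight (card (verts t)) \<ge> 0"
  unfolding weight_def
proof (intro prod_nonneg divide_nonneg_nonneg)
  fix i assume "i \<in> {2..card (verts t)}"
  then have "i - 1 \<in> {1..card (verts T)}" "i \<in> {1..card (verts T)}"
    using card_verts_rooted_subtree[OF assms] by auto
  then show "p (i - 1) \<ge> 0" "s i \<ge> 0" using probs by blast+
qed

lemma sum_weight_by_size:
  "(\<Sum>t\<in>S. weight (card (verts t))) =
     (\<Sum>m=1..card (verts T). weight m * real (card (rooted_subtrees_of_size T r m)))"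
proof -
  have fin: "finite S" using finite_rooted_subtrees[OF tree] .
  have "(\<Sum>t\<in>S. weight (card (verts t))) =
      (\<Sum>m=1..card (verts T). \<Sum>t | t \<in> S \<and> card (verts t) = m. weight (card (verts t)))"
    using card_verts_rooted_subtree by (intro sum.group[symmetric]) (auto simp: fin)
  also have "\<dots> = (\<Sum>m=1..card (verts T). weight m * real (card (rooted_subtrees_of_size T r m)))"
  proof (rule sum.cong)
    fix m
    have "{t \<in> S. card (verts t) = m} = rooted_subtrees_of_size T r m"
      by (auto simp: rooted_subtrees_def rooted_subtrees_of_size_def)
    moreover have "(\<Sum>t | t \<in> S \<and> card (verts t) = m. weight (card (verts t))) =
        (\<Sum>t | t \<in> S \<and> card (verts t) = m. weight m)"
      by (rule sum.cong) auto
    ultimately show "(\<Sum>t | t \<in> S \<and> card (verts t) = m. weight (card (verts t))) =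
        weight m * real (card (rooted_subtrees_of_size T r m))"
      by simp
  qed simp
  finally show ?thesis .
qed

text \<open>The single root alone contributes weight 1, the empty product.\<close>

lemma sum_weight_pos: "(\<Sum>t\<in>S. weight (card (verts t))) > 0"
proof (rule sum_pos2)
  show "Graph {r} {} \<in> S" using root_only_in_rooted_subtrees[OF tree root] .
  show "0 < weight (card (verts (Graph {r} {})))" by (simp add: weight_def)
qed (use finite_rooted_subtrees[OF tree] weight_nonneg in auto)

lemma obtain_invariant_pmf:
  obtains \<mu> \<nu> where "invariant_distribution S K \<mu>"
    and "\<nu> * (\<Sum>t\<in>S. weight (card (verts t))) = 1"
    and "\<And>t. pmf \<mu> t = \<nu> * weight (card (verts t)) * indicator S t"
proof -
  define \<nu> where "\<nu> = inverse (\<Sum>t\<in>S. weight (card (verts t)))"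
  have \<nu>: "\<nu> * (\<Sum>t\<in>S. weight (card (verts t))) = 1" "\<nu> \<ge> 0"
    using sum_weight_pos by (auto simp: \<nu>_def)
  note fin = finite_rooted_subtrees[OF tree, of r]
  obtain \<mu> where \<mu>: "\<And>t. pmf \<mu> t = \<nu> * weight (card (verts t)) * indicator S t"
    using pmf_of_finite_weights[OF fin, of "\<lambda>t. \<nu> * weight (card (verts t))"] \<nu> weight_nonneg
    by (auto simp flip: sum_distrib_left)
  have "invariant_distribution S K \<mu>"
  proof (rule invariant_if_reversible[OF fin kernel_closed])
    show "set_pmf \<mu> \<subseteq> S" using \<mu> by (auto simp: set_pmf_iff indicator_def split: if_splits)
  next
    fix x y assume "x \<in> S" "y \<in> S"
    then show "pmf \<mu> x * pmf (K x) y = pmf \<mu> y * pmf (K y) x"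
      using kernel_reversible[of x y] by (simp add: \<mu> mult.assoc)
  qed
  then show thesis using that \<nu>(1) \<mu> by blast
qed

lemma invariant_unique:
  assumes "invariant_distribution S K \<mu>" "invariant_distribution S K \<mu>'"
  shows "\<mu> = \<mu>'"
  using invariant_unique_if_reachable[OF finite_rooted_subtrees[OF tree] kernel_closed
      kernel_reaches_root root_only_in_rooted_subtrees[OF tree root] assms] .

end

theorem proposition33:
  fixes T :: "'a graph" and r :: 'a and p q s :: "nat \<Rightarrow> real"
  assumes "finite_tree T"
    and "card (verts T) \<ge> 2"
    and "r \<in> verts T"
    and "\<And>i. i \<in> {1..card (verts T)} \<Longrightarrow> p i \<ge> 0 \<and> q i \<ge> 0 \<and> s i \<ge> 0 \<and> p i + q i + s i = 1"
    and "\<And>i. i \<in> {1..card (verts T)} \<Longrightarrow> s i > 0"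
  shows "(\<exists>!\<mu>. invariant_distribution (rooted_subtrees T r) (subtree_kernel T r p q s) \<mu>) \<and>
    (\<exists>\<nu>. \<nu> * (\<Sum>m=1..card (verts T).
             (\<Prod>i=2..m. p (i - 1) / s i) * real (card (rooted_subtrees_of_size T r m))) = 1 \<and>
         (\<forall>\<mu>. invariant_distribution (rooted_subtrees T r) (subtree_kernel T r p q s) \<mu> \<longrightarrow>
           (\<forall>t. pmf \<mu> t = \<nu> * (\<Prod>i=2..card (verts t). p (i - 1) / s i) *
                            indicator (rooted_subtrees T r) t)))"
proof -
  interpret lazy_subtree_walk T r p q s by unfold_locales (use assms in auto)
  obtain \<mu> \<nu> where inv: "invariant_distribution S K \<mu>"
    and \<nu>: "\<nu> * (\<Sum>t\<in>S. weight (card (verts t))) = 1"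
    and pmf: "\<And>t. pmf \<mu> t = \<nu> * weight (card (verts t)) * indicator S t"
    using obtain_invariant_pmf by blast
  have "\<exists>!\<mu>. invariant_distribution S K \<mu>" using inv invariant_unique by blast
  moreover have "\<forall>\<mu>'. invariant_distribution S K \<mu>' \<longrightarrow>
      (\<forall>t. pmf \<mu>' t = \<nu> * weight (card (verts t)) * indicator S t)"
    using inv invariant_unique pmf by blast
  ultimately show ?thesis
    using \<nu>[unfolded sum_weight_by_size] unfolding weight_def by blast
qed

end
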